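(* Let a finite group $G$ act on a finite set $X$, and let $\pi_X=\mathbb{R}X$ be the corresponding permutation representation of $G$ on the real vector space with basis $X$. Let $B=\mathrm{End}_G(\pi_X)$, with $l_B(x)=\mathrm{Tr}_{\pi_X}(x)/|G|$ and with $\star:B\to B$ the adjoint (transposition) with respect to the $G$-invariant scalar product on $\pi_X$ for which $X$ is an orthonormal basis. Let $B_X$, with functional $l_{B_X}$ and involution $\star_X$, be the algebra built from the $G$-orbits on $X\times X$ as defined in the context. Then there is an algebra isomorphism $B\cong B_X$ identifying $l_B$ with $l_{B_X}$ and $\star$ with $\star_X$.
   Context: $G$ acts on $X^n$ diagonally: $g(x_1,\dots,x_n)=(g(x_1),\dots,g(x_n))$. Let $\mathcal{B}_n=X^n/G$ be the set of orbits. For $\bar x=(x_1,\dots,x_n)\in X^n$ let $\mathrm{Aut}\,\bar x=\bigcap_i\mathrm{Aut}\,x_i$ be its stabilizer in $G$; $|\mathrm{Aut}\,\bar x|$ depends only on the orbit of $\bar x$, so $|\mathrm{Aut}\,b|$ is defined for $b\in\mathcal{B}_n$. $B_X$ is the real vector space with basis $\mathcal{B}_2$. The map $(x_1,x_2)\mapsto(x_2,x_1)$ induces a linear involution $\star_X:B_X\to B_X$, written $b\mapsto b^\star$. For $b_1,b_2,b_3\in\mathcal{B}_2$ define (and extend multilinearly) $$(b_1,b_2)_X=\frac{\delta_{b_1,b_2^\star}}{|\mathrm{Aut}\,b_1|},\qquad (b_1,b_2,b_3)_X=\sum\frac{1}{|\mathrm{Aut}(x_1,x_2,x_3)|},$$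 where the last sum is over the $G$-orbits of triples $(x_1,x_2,x_3)\in X^3$ with $(x_1,x_2)\in b_1$, $(x_2,x_3)\in b_2$, $(x_3,x_1)\in b_3$. The multiplication on $B_X$ is defined by $(b_1b_2,b_3)_X=(b_1,b_2,b_3)_X$. The unit $e$ of $B_X$ is the sum of all orbits in $\mathcal{B}_2$ contained in the diagonal $\{(x,x):x\in X\}$, and $l_{B_X}(b)=(b,e)_X$. *)

theory Defs
  imports "HOL-Algebra.Group_Action" "HOL-Algebra.Module" "HOL-Algebra.QuotRing"
    "HOL-Analysis.Finite_Function_Topology"
begin

text \<open>The real vector space with basis \<open>S\<close>, realised as the finitely supported real functions
  with support in \<open>S\<close>; the basis vector of \<open>s\<close> is \<open>Poly_Mapping.single s 1\<close>.\<close>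

definition free_space :: "'a set \<Rightarrow> ('a \<Rightarrow>\<^sub>0 real) set" where
  "free_space S = {v. Poly_Mapping.keys v \<subseteq> S}"

abbreviation basis_vec :: "'a \<Rightarrow> ('a \<Rightarrow>\<^sub>0 real)" where
  "basis_vec s \<equiv> Poly_Mapping.single s 1"

abbreviation coord :: "('a \<Rightarrow>\<^sub>0 real) \<Rightarrow> 'a \<Rightarrow> real" where
  "coord \<equiv> Poly_Mapping.lookup"


subsection \<open>The endomorphism algebra of the permutation representation\<close>

definition perm_rep :: "'x set \<Rightarrow> ('g \<Rightarrow> 'x \<Rightarrow> 'x) \<Rightarrow> 'g \<Rightarrow> ('x \<Rightarrow>\<^sub>0 real) \<Rightarrow> ('x \<Rightarrow>\<^sub>0 real)" where
  "perm_rep X \<phi> g v = (\<Sum>x\<in>X. coord v x *\<^sub>R basis_vec (\<phi> g x))"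

definition std_inner :: "'x set \<Rightarrow> ('x \<Rightarrow>\<^sub>0 real) \<Rightarrow> ('x \<Rightarrow>\<^sub>0 real) \<Rightarrow> real" where
  "std_inner X v w = (\<Sum>x\<in>X. coord v x * coord w x)"

text \<open>Linear endomorphisms of \<open>free_space X\<close>, as functions that are \<open>undefined\<close> off that space,
  so that equality of functions is equality of endomorphisms.\<close>

definition lin_endos :: "'x set \<Rightarrow> (('x \<Rightarrow>\<^sub>0 real) \<Rightarrow> ('x \<Rightarrow>\<^sub>0 real)) set" where
  "lin_endos X = {f \<in> free_space X \<rightarrow>\<^sub>E free_space X.
     (\<forall>u\<in>free_space X. \<forall>v\<in>free_space X. f (u + v) = f u + f v) \<and>
     (\<forall>c. \<forall>v\<in>free_space X. f (c *\<^sub>R v) = c *\<^sub>R f v)}"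

definition End_alg :: "('g, 'm) monoid_scheme \<Rightarrow> 'x set \<Rightarrow> ('g \<Rightarrow> 'x \<Rightarrow> 'x)
    \<Rightarrow> (real, ('x \<Rightarrow>\<^sub>0 real) \<Rightarrow> ('x \<Rightarrow>\<^sub>0 real)) module" where
  "End_alg G X \<phi> =
    \<lparr> carrier = {f \<in> lin_endos X. \<forall>g\<in>carrier G. \<forall>v\<in>free_space X.
                   f (perm_rep X \<phi> g v) = perm_rep X \<phi> g (f v)},
      monoid.mult = compose (free_space X),
      one = (\<lambda>v\<in>free_space X. v),
      zero = (\<lambda>v\<in>free_space X. 0),
      add = (\<lambda>f h. \<lambda>v\<in>free_space X. f v + h v),
      smult = (\<lambda>c f. \<lambda>v\<in>free_space X. c *\<^sub>R f v) \<rparr>"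

definition endo_trace :: "'x set \<Rightarrow> (('x \<Rightarrow>\<^sub>0 real) \<Rightarrow> ('x \<Rightarrow>\<^sub>0 real)) \<Rightarrow> real" where
  "endo_trace X f = (\<Sum>x\<in>X. coord (f (basis_vec x)) x)"

definition End_functional :: "('g, 'm) monoid_scheme \<Rightarrow> 'x set
    \<Rightarrow> (('x \<Rightarrow>\<^sub>0 real) \<Rightarrow> ('x \<Rightarrow>\<^sub>0 real)) \<Rightarrow> real" where
  "End_functional G X f = endo_trace X f / real (order G)"

definition endo_adjoint :: "'x set \<Rightarrow> (('x \<Rightarrow>\<^sub>0 real) \<Rightarrow> ('x \<Rightarrow>\<^sub>0 real))
    \<Rightarrow> (('x \<Rightarrow>\<^sub>0 real) \<Rightarrow> ('x \<Rightarrow>\<^sub>0 real))" where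
  "endo_adjoint X f = (THE f'. f' \<in> lin_endos X \<and>
     (\<forall>v\<in>free_space X. \<forall>w\<in>free_space X. std_inner X (f v) w = std_inner X v (f' w)))"


subsection \<open>The algebra of orbits on pairs\<close>

text \<open>The restriction to \<open>X \<times> Y\<close> makes this a \<^locale>\<open>group_action\<close>, whose permutations are
  \<open>undefined\<close> off the set acted on.\<close>

definition prod_action :: "'x set \<Rightarrow> ('g \<Rightarrow> 'x \<Rightarrow> 'x) \<Rightarrow> 'y set \<Rightarrow> ('g \<Rightarrow> 'y \<Rightarrow> 'y)
    \<Rightarrow> 'g \<Rightarrow> 'x \<times> 'y \<Rightarrow> 'x \<times> 'y" where
  "prod_action X \<phi> Y \<psi> g = restrict (map_prod (\<phi> g) (\<psi> g)) (X \<times> Y)"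

abbreviation act2 :: "'x set \<Rightarrow> ('g \<Rightarrow> 'x \<Rightarrow> 'x) \<Rightarrow> 'g \<Rightarrow> 'x \<times> 'x \<Rightarrow> 'x \<times> 'x" where
  "act2 X \<phi> \<equiv> prod_action X \<phi> X \<phi>"

abbreviation act3 :: "'x set \<Rightarrow> ('g \<Rightarrow> 'x \<Rightarrow> 'x) \<Rightarrow> 'g \<Rightarrow> 'x \<times> 'x \<times> 'x \<Rightarrow> 'x \<times> 'x \<times> 'x" where
  "act3 X \<phi> \<equiv> prod_action X \<phi> (X \<times> X) (act2 X \<phi>)"

definition orbits2 :: "('g, 'm) monoid_scheme \<Rightarrow> 'x set \<Rightarrow> ('g \<Rightarrow> 'x \<Rightarrow> 'x) \<Rightarrow> ('x \<times> 'x) set set" where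
  "orbits2 G X \<phi> = orbits G (X \<times> X) (act2 X \<phi>)"

definition orbits3 :: "('g, 'm) monoid_scheme \<Rightarrow> 'x set \<Rightarrow> ('g \<Rightarrow> 'x \<Rightarrow> 'x)
    \<Rightarrow> ('x \<times> 'x \<times> 'x) set set" where
  "orbits3 G X \<phi> = orbits G (X \<times> X \<times> X) (act3 X \<phi>)"

text \<open>The order of the stabilizer of a point of the orbit \<open>b\<close>; it does not depend on the point.\<close>

definition aut_card :: "('g, 'm) monoid_scheme \<Rightarrow> ('g \<Rightarrow> 'p \<Rightarrow> 'p) \<Rightarrow> 'p set \<Rightarrow> nat" where
  "aut_card G \<psi> b = card (stabilizer G \<psi> (SOME p. p \<in> b))"

definition orbit_star :: "('x \<times> 'x) set \<Rightarrow> ('x \<times> 'x) set" where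
  "orbit_star b = prod.swap ` b"

definition pair_coeff :: "('g, 'm) monoid_scheme \<Rightarrow> 'x set \<Rightarrow> ('g \<Rightarrow> 'x \<Rightarrow> 'x)
    \<Rightarrow> ('x \<times> 'x) set \<Rightarrow> ('x \<times> 'x) set \<Rightarrow> real" where
  "pair_coeff G X \<phi> b1 b2 =
     (if b1 = orbit_star b2 then 1 / real (aut_card G (act2 X \<phi>) b1) else 0)"

definition triple_coeff :: "('g, 'm) monoid_scheme \<Rightarrow> 'x set \<Rightarrow> ('g \<Rightarrow> 'x \<Rightarrow> 'x)
    \<Rightarrow> ('x \<times> 'x) set \<Rightarrow> ('x \<times> 'x) set \<Rightarrow> ('x \<times> 'x) set \<Rightarrow> real" where
  "triple_coeff G X \<phi> b1 b2 b3 =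
     (\<Sum>t \<in> {t \<in> orbits3 G X \<phi>. \<forall>(x1, x2, x3) \<in> t. (x1, x2) \<in> b1 \<and> (x2, x3) \<in> b2 \<and> (x3, x1) \<in> b3}.
        1 / real (aut_card G (act3 X \<phi>) t))"

definition pair_form :: "('g, 'm) monoid_scheme \<Rightarrow> 'x set \<Rightarrow> ('g \<Rightarrow> 'x \<Rightarrow> 'x)
    \<Rightarrow> (('x \<times> 'x) set \<Rightarrow>\<^sub>0 real) \<Rightarrow> (('x \<times> 'x) set \<Rightarrow>\<^sub>0 real) \<Rightarrow> real" where
  "pair_form G X \<phi> u v =
     (\<Sum>b1\<in>orbits2 G X \<phi>. \<Sum>b2\<in>orbits2 G X \<phi>. coord u b1 * coord v b2 * pair_coeff G X \<phi> b1 b2)"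

definition triple_form :: "('g, 'm) monoid_scheme \<Rightarrow> 'x set \<Rightarrow> ('g \<Rightarrow> 'x \<Rightarrow> 'x)
    \<Rightarrow> (('x \<times> 'x) set \<Rightarrow>\<^sub>0 real) \<Rightarrow> (('x \<times> 'x) set \<Rightarrow>\<^sub>0 real) \<Rightarrow> (('x \<times> 'x) set \<Rightarrow>\<^sub>0 real) \<Rightarrow> real" where
  "triple_form G X \<phi> u v w =
     (\<Sum>b1\<in>orbits2 G X \<phi>. \<Sum>b2\<in>orbits2 G X \<phi>. \<Sum>b3\<in>orbits2 G X \<phi>.
        coord u b1 * coord v b2 * coord w b3 * triple_coeff G X \<phi> b1 b2 b3)"

definition orbit_mult :: "('g, 'm) monoid_scheme \<Rightarrow> 'x set \<Rightarrow> ('g \<Rightarrow> 'x \<Rightarrow> 'x)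
    \<Rightarrow> (('x \<times> 'x) set \<Rightarrow>\<^sub>0 real) \<Rightarrow> (('x \<times> 'x) set \<Rightarrow>\<^sub>0 real) \<Rightarrow> (('x \<times> 'x) set \<Rightarrow>\<^sub>0 real)" where
  "orbit_mult G X \<phi> u v = (THE p. p \<in> free_space (orbits2 G X \<phi>) \<and>
     (\<forall>w\<in>free_space (orbits2 G X \<phi>). pair_form G X \<phi> p w = triple_form G X \<phi> u v w))"

definition orbit_unit :: "('g, 'm) monoid_scheme \<Rightarrow> 'x set \<Rightarrow> ('g \<Rightarrow> 'x \<Rightarrow> 'x)
    \<Rightarrow> (('x \<times> 'x) set \<Rightarrow>\<^sub>0 real)" where
  "orbit_unit G X \<phi> = (\<Sum>b \<in> {b \<in> orbits2 G X \<phi>. b \<subseteq> {(x, x) | x. x \<in> X}}. basis_vec b)"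

definition orbit_alg :: "('g, 'm) monoid_scheme \<Rightarrow> 'x set \<Rightarrow> ('g \<Rightarrow> 'x \<Rightarrow> 'x)
    \<Rightarrow> (real, ('x \<times> 'x) set \<Rightarrow>\<^sub>0 real) module" where
  "orbit_alg G X \<phi> =
    \<lparr> carrier = free_space (orbits2 G X \<phi>),
      monoid.mult = orbit_mult G X \<phi>,
      one = orbit_unit G X \<phi>,
      zero = 0,
      add = (+),
      smult = (*\<^sub>R) \<rparr>"

definition orbit_functional :: "('g, 'm) monoid_scheme \<Rightarrow> 'x set \<Rightarrow> ('g \<Rightarrow> 'x \<Rightarrow> 'x)
    \<Rightarrow> (('x \<times> 'x) set \<Rightarrow>\<^sub>0 real) \<Rightarrow> real" where
  "orbit_functional G X \<phi> u = pair_form G X \<phi> u (orbit_unit G X \<phi>)"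

definition orbit_alg_star :: "('g, 'm) monoid_scheme \<Rightarrow> 'x set \<Rightarrow> ('g \<Rightarrow> 'x \<Rightarrow> 'x)
    \<Rightarrow> (('x \<times> 'x) set \<Rightarrow>\<^sub>0 real) \<Rightarrow> (('x \<times> 'x) set \<Rightarrow>\<^sub>0 real)" where
  "orbit_alg_star G X \<phi> u = (\<Sum>b\<in>orbits2 G X \<phi>. coord u b *\<^sub>R basis_vec (orbit_star b))"


subsection \<open>Isomorphisms of real algebras\<close>

definition real_alg_iso :: "(real, 'a) module \<Rightarrow> (real, 'b) module \<Rightarrow> ('a \<Rightarrow> 'b) set" where
  "real_alg_iso A B = {h \<in> ring_iso A B.
     \<forall>c. \<forall>a\<in>carrier A. h (c \<odot>\<^bsub>A\<^esub> a) = c \<odot>\<^bsub>B\<^esub> h a}"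

end

theory Submission
  imports Defs
begin

text \<open>An endomorphism of \<open>\<real>X\<close> is the same as its matrix on \<open>X \<times> X\<close>, and it commutes with \<open>G\<close> exactly
  when its matrix is constant on the \<open>G\<close>-orbits of \<open>X \<times> X\<close> (\<open>End_carrier_iff\<close>). Reading an element
  of the orbit space as the function \<open>(x, y) \<mapsto>\<close> coefficient of the orbit of \<open>(x, y)\<close>, the
  isomorphism is then the identity on matrices. What has to be seen is that the structure of the
  orbit algebra, which is defined by weighted sums over orbits, becomes the usual matrix structure.

  The reason is the orbit-stabilizer theorem: an orbit \<open>b\<close> has weight
  \<open>1 / |Aut b| = |b| / |G|\<close>, so a sum of an orbit function with these weights is \<open>1 / |G|\<close> times the sum
  over all points (\<open>sum_orbits_weighted\<close>). For invariant matrices \<open>u\<close>, \<open>v\<close>, \<open>w\<close> this turns the two forms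
  into
  \<open>(u, v) = (1 / |G|) \<Sum>\<^bsub>x, y\<^esub> u(x, y) v(y, x) = Tr (u v) / |G|\<close> (\<open>pair_form_average\<close>) and
  \<open>(u, v, w) = (1 / |G|) \<Sum>\<^bsub>x, y, z\<^esub> u(x, y) v(y, z) w(z, x) = Tr (u v w) / |G|\<close>
  (\<open>triple_form_average\<close>).
  Since the pairing is nondegenerate, the product determined by \<open>(u v, w) = (u, v, w)\<close> can only be the
  matrix product (\<open>orbit_mult_eqI\<close>). The unit is the identity matrix, so that
  \<open>l(u) = (u, e) = Tr u / |G|\<close>, and exchanging the two points of a pair is transposition, which
  is also what the adjoint is in an orthonormal basis (\<open>endo_adjoint_eq_transpose\<close>).\<close>

section \<open>Endomorphisms of a free space and their matrices\<close>

lemma coord_scaleR [simp]: "coord (c *\<^sub>R v) i = c * coord v i"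
proof -
  have "finite {i. c * coord v i \<noteq> 0}"
    by (rule finite_subset[OF _ finite_lookup[of v]]) auto
  then show ?thesis
    by (simp add: scaleR_poly_mapping_def)
qed

lemma free_space_iff: "v \<in> free_space S \<longleftrightarrow> (\<forall>i. i \<notin> S \<longrightarrow> coord v i = 0)"
  by (auto simp: free_space_def in_keys_iff)

lemma free_space_closed [simp, intro]:
  shows "0 \<in> free_space S"
    and "u \<in> free_space S \<Longrightarrow> v \<in> free_space S \<Longrightarrow> u + v \<in> free_space S"
    and "v \<in> free_space S \<Longrightarrow> c *\<^sub>R v \<in> free_space S"
    and "s \<in> S \<Longrightarrow> basis_vec s \<in> free_space S"
  by (auto simp: free_space_iff lookup_add lookup_single when_def)

lemma free_space_sum:
  "(\<And>a. a \<in> A \<Longrightarrow> w a \<in> free_space S) \<Longrightarrow> (\<Sum>a\<in>A. w a) \<in> free_space S"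
  by (induction A rule: infinite_finite_induct) auto

lemma coord_basis_sum:
  assumes "finite S"
  shows "coord (\<Sum>x\<in>S. c x *\<^sub>R basis_vec x) i = (if i \<in> S then c i else 0)"
  using assms by (simp add: lookup_sum lookup_single when_def if_distrib cong: if_cong)

lemma basis_expansion:
  assumes "finite S" "v \<in> free_space S"
  shows "(\<Sum>x\<in>S. coord v x *\<^sub>R basis_vec x) = v"
  using assms by (intro poly_mapping_eqI) (auto simp: coord_basis_sum free_space_iff)

definition mat_entry :: "(('x \<Rightarrow>\<^sub>0 real) \<Rightarrow> ('x \<Rightarrow>\<^sub>0 real)) \<Rightarrow> 'x \<Rightarrow> 'x \<Rightarrow> real" where
  "mat_entry f x y = coord (f (basis_vec y)) x"

definition mat_endo :: "'x set \<Rightarrow> ('x \<Rightarrow> 'x \<Rightarrow> real) \<Rightarrow> (('x \<Rightarrow>\<^sub>0 real) \<Rightarrow> ('x \<Rightarrow>\<^sub>0 real))" where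
  "mat_endo X M = (\<lambda>v\<in>free_space X. \<Sum>x\<in>X. (\<Sum>y\<in>X. M x y * coord v y) *\<^sub>R basis_vec x)"

lemma lin_endosD:
  assumes "f \<in> lin_endos X"
  shows "v \<in> free_space X \<Longrightarrow> f v \<in> free_space X"
    and "u \<in> free_space X \<Longrightarrow> v \<in> free_space X \<Longrightarrow> f (u + v) = f u + f v"
    and "v \<in> free_space X \<Longrightarrow> f (c *\<^sub>R v) = c *\<^sub>R f v"
    and "v \<notin> free_space X \<Longrightarrow> f v = undefined"
  using assms by (auto simp: lin_endos_def PiE_def extensional_def)

lemma lin_endos_lincomb:
  assumes f: "f \<in> lin_endos X" and "finite A" "\<And>a. a \<in> A \<Longrightarrow> w a \<in> free_space X"
  shows "f (\<Sum>a\<in>A. c a *\<^sub>R w a) = (\<Sum>a\<in>A. c a *\<^sub>R f (w a))"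
  using assms(2,3)
proof (induction A rule: finite_induct)
  case empty
  have "f (0 *\<^sub>R 0) = 0 *\<^sub>R f 0"
    by (rule lin_endosD(3)[OF f]) simp
  then show ?case by simp
next
  case (insert a A)
  then show ?case
    by (simp add: lin_endosD(2,3)[OF f] free_space_sum)
qed

lemma coord_lin_endo:
  assumes f: "f \<in> lin_endos X" and X: "finite X" and v: "v \<in> free_space X"
  shows "coord (f v) x = (\<Sum>y\<in>X. mat_entry f x y * coord v y)"
proof -
  have "f v = f (\<Sum>y\<in>X. coord v y *\<^sub>R basis_vec y)"
    by (simp only: basis_expansion[OF X v])
  also have "\<dots> = (\<Sum>y\<in>X. coord v y *\<^sub>R f (basis_vec y))"
    by (rule lin_endos_lincomb[OF f X]) auto
  finally show ?thesis
    by (simp add: lookup_sum mat_entry_def mult.commute)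
qed

lemma lin_endo_eqI:
  assumes f: "f \<in> lin_endos X" and f': "f' \<in> lin_endos X" and X: "finite X"
    and eq: "\<And>x y. x \<in> X \<Longrightarrow> y \<in> X \<Longrightarrow> mat_entry f x y = mat_entry f' x y"
  shows "f = f'"
proof
  fix v
  show "f v = f' v"
  proof (cases "v \<in> free_space X")
    case True
    show ?thesis
    proof (rule poly_mapping_eqI)
      fix x
      show "coord (f v) x = coord (f' v) x"
      proof (cases "x \<in> X")
        case True
        then show ?thesis
          using \<open>v \<in> free_space X\<close> by (simp add: coord_lin_endo[OF f X] coord_lin_endo[OF f' X] eq)
      next
        case False
        then show ?thesis
          using True lin_endosD(1)[OF f True] lin_endosD(1)[OF f' True] by (simp add: free_space_iff)
      qed
    qed
  qed (simp add: lin_endosD(4)[OF f] lin_endosD(4)[OF f'])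
qed

lemma coord_mat_endo:
  assumes "finite X" "v \<in> free_space X"
  shows "coord (mat_endo X M v) x = (if x \<in> X then \<Sum>y\<in>X. M x y * coord v y else 0)"
  using assms by (simp add: mat_endo_def coord_basis_sum)

lemma mat_entry_mat_endo:
  assumes "finite X" "x \<in> X" "y \<in> X"
  shows "mat_entry (mat_endo X M) x y = M x y"
  using assms by (simp add: mat_entry_def coord_mat_endo lookup_single when_def if_distrib cong: if_cong)

lemma mat_endo_lin_endos:
  assumes "finite X"
  shows "mat_endo X M \<in> lin_endos X"
proof -
  have "mat_endo X M \<in> free_space X \<rightarrow>\<^sub>E free_space X"
    by (auto simp: mat_endo_def intro!: free_space_sum)
  moreover have "mat_endo X M (u + v) = mat_endo X M u + mat_endo X M v"
    if "u \<in> free_space X" "v \<in> free_space X" for u v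
    using assms that
    by (intro poly_mapping_eqI) (auto simp: lookup_add coord_mat_endo distrib_left sum.distrib)
  moreover have "mat_endo X M (c *\<^sub>R v) = c *\<^sub>R mat_endo X M v" if "v \<in> free_space X" for c v
    using assms that
    by (intro poly_mapping_eqI) (auto simp: coord_mat_endo sum_distrib_left mult_ac)
  ultimately show ?thesis
    by (simp add: lin_endos_def)
qed

lemma mat_entry_compose:
  assumes "f \<in> lin_endos X" "f' \<in> lin_endos X" "finite X" "z \<in> X"
  shows "mat_entry (compose (free_space X) f f') x z =
    (\<Sum>y\<in>X. mat_entry f x y * mat_entry f' y z)"
  using assms coord_lin_endo[OF assms(1,3) lin_endosD(1)[OF assms(2)], of "basis_vec z" x]
  by (simp add: mat_entry_def compose_def)

text \<open>The transpose satisfies the adjunction identity by exchanging the two sums. Conversely that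
  identity on basis vectors prescribes every matrix entry of an adjoint, hence the adjoint.\<close>

lemma endo_adjoint_eq_transpose:
  assumes f: "f \<in> lin_endos X" and X: "finite X"
  shows "endo_adjoint X f = mat_endo X (\<lambda>x y. mat_entry f y x)"
  unfolding endo_adjoint_def
proof (rule the_equality)
  let ?t = "mat_endo X (\<lambda>x y. mat_entry f y x)"
  have "std_inner X (f v) w = std_inner X v (?t w)"
    if "v \<in> free_space X" "w \<in> free_space X" for v w
  proof -
    have "std_inner X (f v) w = (\<Sum>x\<in>X. \<Sum>y\<in>X. mat_entry f x y * coord v y * coord w x)"
      using that by (simp add: std_inner_def coord_lin_endo[OF f X] sum_distrib_right)
    also have "\<dots> = (\<Sum>y\<in>X. \<Sum>x\<in>X. mat_entry f x y * coord v y * coord w x)"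
      by (rule sum.swap)
    also have "\<dots> = std_inner X v (?t w)"
      using that X by (simp add: std_inner_def coord_mat_endo sum_distrib_left mult_ac)
    finally show ?thesis .
  qed
  then show "?t \<in> lin_endos X \<and> (\<forall>v\<in>free_space X. \<forall>w\<in>free_space X.
      std_inner X (f v) w = std_inner X v (?t w))"
    using mat_endo_lin_endos[OF X] by blast
next
  fix f'
  assume f': "f' \<in> lin_endos X \<and> (\<forall>v\<in>free_space X. \<forall>w\<in>free_space X.
      std_inner X (f v) w = std_inner X v (f' w))"
  show "f' = mat_endo X (\<lambda>x y. mat_entry f y x)"
  proof (rule lin_endo_eqI)
    fix x y assume xy: "x \<in> X" "y \<in> X"
    then have "std_inner X (f (basis_vec x)) (basis_vec y) = std_inner X (basis_vec x) (f' (basis_vec y))"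
      using f' by simp
    then show "mat_entry f' x y = mat_entry (mat_endo X (\<lambda>x y. mat_entry f y x)) x y"
      using xy X by (simp add: mat_entry_mat_endo)
        (simp add: std_inner_def mat_entry_def lookup_single when_def if_distrib if_distribR cong: if_cong)
  qed (use f' X mat_endo_lin_endos in auto)
qed

section \<open>Orbits and stabilizers\<close>

lemma group_action_prod:
  assumes "group_action G X \<phi>" "group_action G Y \<psi>"
  shows "group_action G (X \<times> Y) (prod_action X \<phi> Y \<psi>)"
proof -
  interpret \<phi>: group_action G X \<phi> by fact
  interpret \<psi>: group_action G Y \<psi> by fact
  interpret group G using \<phi>.group_hom by (simp add: group_hom_def)
  have bij: "prod_action X \<phi> Y \<psi> g \<in> Bij (X \<times> Y)" if "g \<in> carrier G" for g
    using \<phi>.bij_prop0[OF that] \<psi>.bij_prop0[OF that]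
    by (auto simp: Bij_def prod_action_def intro!: bij_betw_map_prod)
  have mult: "prod_action X \<phi> Y \<psi> (g \<otimes>\<^bsub>G\<^esub> h) =
      compose (X \<times> Y) (prod_action X \<phi> Y \<psi> g) (prod_action X \<phi> Y \<psi> h)"
    if "g \<in> carrier G" "h \<in> carrier G" for g h
    using that
    by (auto simp: prod_action_def compose_def fun_eq_iff \<phi>.composition_rule \<psi>.composition_rule
        \<phi>.element_image[OF _ _ refl] \<psi>.element_image[OF _ _ refl])
  show ?thesis
    unfolding group_action_def group_hom_def group_hom_axioms_def hom_def
    using bij mult by (auto simp: group_BijGroup is_group) (auto simp: BijGroup_def)
qed

context group_action
begin

lemma orbit_eqI:
  assumes "x \<in> E" "y \<in> orbit G \<phi> x"
  shows "orbit G \<phi> y = orbit G \<phi> x"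
proof -
  have y: "y \<in> E"
    using assms element_image by (auto simp: orbit_def)
  have *: "orbit G \<phi> z \<subseteq> orbit G \<phi> w" if "w \<in> E" "z \<in> E" "z \<in> orbit G \<phi> w" for w z
  proof
    fix u assume u: "u \<in> orbit G \<phi> z"
    then have "u \<in> E"
      using that element_image by (auto simp: orbit_def)
    then show "u \<in> orbit G \<phi> w"
      using orbit_trans[OF that(1,2) _ that(3) u] by simp
  qed
  show ?thesis
    using *[OF assms(1) y assms(2)] *[OF y assms(1) orbit_sym[OF assms(1) y assms(2)]] by simp
qed

lemma mem_orbits_iff:
  assumes "b \<in> orbits G E \<phi>" "x \<in> E"
  shows "x \<in> b \<longleftrightarrow> b = orbit G \<phi> x"
proof -
  obtain y where "y \<in> E" "b = orbit G \<phi> y"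
    using assms(1) by (auto simp: orbits_def)
  then show ?thesis
    using orbit_eqI[of y x] orbit_refl[OF assms(2)] by blast
qed

lemma some_mem_orbit:
  assumes "b \<in> orbits G E \<phi>"
  shows "(SOME p. p \<in> b) \<in> b"
  using assms orbit_refl unfolding orbits_def by (metis (mono_tags, lifting) mem_Collect_eq someI)

lemma orbit_in_orbits: "x \<in> E \<Longrightarrow> orbit G \<phi> x \<in> orbits G E \<phi>"
  by (auto simp: orbits_def)

lemma finite_orbits: "finite E \<Longrightarrow> finite (orbits G E \<phi>)"
  by (auto simp: orbits_def)

lemma card_orbit_mult_aut_card:
  assumes "b \<in> orbits G E \<phi>"
  shows "card b * aut_card G \<phi> b = order G"
proof -
  have b: "(SOME p. p \<in> b) \<in> b"
    by (rule some_mem_orbit[OF assms])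
  then have E: "(SOME p. p \<in> b) \<in> E"
    using assms orbits_coverture by blast
  show ?thesis
    using orbit_stabilizer_theorem[OF E] mem_orbits_iff[OF assms E] b by (simp add: aut_card_def)
qed

lemma order_pos:
  assumes "finite (carrier G)"
  shows "order G > 0"
proof -
  interpret group G using group_hom by (simp add: group_hom_def)
  show ?thesis using assms by (simp add: order_gt_0_iff_finite)
qed

text \<open>By the orbit-stabilizer theorem the weight of \<open>b\<close> is \<open>|b| / |G|\<close>, and \<open>|b|\<close> is absorbed by
  summing over the points of \<open>b\<close>. This removes the stabilizers from all later computations.\<close>

lemma sum_orbits_weighted:
  fixes F :: "'c set \<Rightarrow> real"
  assumes "finite (carrier G)" "finite E"
  shows "(\<Sum>b\<in>orbits G E \<phi>. F b / real (aut_card G \<phi> b)) =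
    (\<Sum>x\<in>E. F (orbit G \<phi> x)) / real (order G)"
proof -
  have "F b / real (aut_card G \<phi> b) = (\<Sum>x\<in>b. F (orbit G \<phi> x)) / real (order G)"
    if b: "b \<in> orbits G E \<phi>" for b
  proof -
    have "F (orbit G \<phi> x) = F b" if "x \<in> b" for x
      using mem_orbits_iff[OF b, of x] orbits_coverture b that by auto
    then have "(\<Sum>x\<in>b. F (orbit G \<phi> x)) = real (card b) * F b"
      by simp
    moreover have "real (order G) = real (card b) * real (aut_card G \<phi> b)"
      using card_orbit_mult_aut_card[OF b] by (metis of_nat_mult)
    moreover have "card b \<noteq> 0"
      using card_orbit_mult_aut_card[OF b] order_pos[OF assms(1)] by (metis mult_0 less_irrefl)
    ultimately show ?thesis
      by simp
  qed
  then have "(\<Sum>b\<in>orbits G E \<phi>. F b / real (aut_card G \<phi> b)) =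
      (\<Sum>b\<in>orbits G E \<phi>. \<Sum>x\<in>b. F (orbit G \<phi> x)) / real (order G)"
    by (simp add: sum_divide_distrib)
  then show ?thesis
    by (simp only: disjoint_sum[OF assms(2)])
qed

end

section \<open>The forms on the orbit space as averages over tuples\<close>

locale finite_action = group_action G X \<phi>
  for G :: "('g, 'm) monoid_scheme" (structure) and X :: "'x set" and \<phi> :: "'g \<Rightarrow> 'x \<Rightarrow> 'x" +
  assumes finite_group: "finite (carrier G)" and finite_set: "finite X"
begin

abbreviation orb :: "'x \<Rightarrow> 'x \<Rightarrow> ('x \<times> 'x) set" where
  "orb x y \<equiv> orbit G (act2 X \<phi>) (x, y)"

abbreviation "\<B> \<equiv> orbits2 G X \<phi>"

sublocale pairs: group_action G "X \<times> X" "act2 X \<phi>"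
  by (intro group_action_prod group_action_axioms)

sublocale triples: group_action G "X \<times> X \<times> X" "act3 X \<phi>"
  by (intro group_action_prod group_action_axioms pairs.group_action_axioms)

lemma act_closed [simp]: "g \<in> carrier G \<Longrightarrow> x \<in> X \<Longrightarrow> \<phi> g x \<in> X"
  by (rule element_image[OF _ _ refl])

lemma orb_eq: "x \<in> X \<Longrightarrow> y \<in> X \<Longrightarrow> orb x y = {(\<phi> g x, \<phi> g y) | g. g \<in> carrier G}"
  by (auto simp: orbit_def prod_action_def)

lemma orbit3_eq: "x \<in> X \<Longrightarrow> y \<in> X \<Longrightarrow> z \<in> X \<Longrightarrow>
    orbit G (act3 X \<phi>) (x, y, z) = {(\<phi> g x, \<phi> g y, \<phi> g z) | g. g \<in> carrier G}"
  by (auto simp: orbit_def prod_action_def)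

lemma orb_in [simp]: "x \<in> X \<Longrightarrow> y \<in> X \<Longrightarrow> orb x y \<in> \<B>"
  using pairs.orbit_in_orbits by (auto simp: orbits2_def)

lemma orbits2_cases:
  assumes "b \<in> \<B>"
  obtains x y where "x \<in> X" "y \<in> X" "b = orb x y"
  using assms by (auto simp: orbits2_def orbits_def)

lemma mem_orb_iff: "b \<in> \<B> \<Longrightarrow> x \<in> X \<Longrightarrow> y \<in> X \<Longrightarrow> (x, y) \<in> b \<longleftrightarrow> b = orb x y"
  using pairs.mem_orbits_iff by (auto simp: orbits2_def)

lemma orb_act: "g \<in> carrier G \<Longrightarrow> x \<in> X \<Longrightarrow> y \<in> X \<Longrightarrow> orb (\<phi> g x) (\<phi> g y) = orb x y"
  using mem_orb_iff[of "orb x y" "\<phi> g x" "\<phi> g y"] orb_eq[of x y] orb_in[of x y] act_closed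
  by blast

lemma finite_orbits2 [simp]: "finite \<B>"
  using pairs.finite_orbits finite_set by (simp add: orbits2_def)

lemma orbit_star_orb: "x \<in> X \<Longrightarrow> y \<in> X \<Longrightarrow> orbit_star (orb x y) = orb y x"
  by (auto simp: orbit_star_def orb_eq image_iff)

lemma orbit_star_star [simp]: "orbit_star (orbit_star b) = b"
  by (simp add: orbit_star_def image_image)

lemma orbit_star_in [simp]: "b \<in> \<B> \<Longrightarrow> orbit_star b \<in> \<B>"
  by (erule orbits2_cases) (simp add: orbit_star_orb)

lemma pair_form_orbits:
  "pair_form G X \<phi> u v =
    (\<Sum>b\<in>\<B>. coord u b * coord v (orbit_star b) / real (aut_card G (act2 X \<phi>) b))"
proof -
  have "(\<Sum>b2\<in>\<B>. coord u b * coord v b2 * pair_coeff G X \<phi> b b2) =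
      coord u b * coord v (orbit_star b) / real (aut_card G (act2 X \<phi>) b)" if "b \<in> \<B>" for b
  proof -
    have "b = orbit_star b2 \<longleftrightarrow> b2 = orbit_star b" for b2
      by (metis orbit_star_star)
    then show ?thesis
      using that by (simp add: pair_coeff_def if_distrib cong: if_cong)
  qed
  then show ?thesis
    by (simp add: pair_form_def)
qed

lemma pair_form_average:
  "pair_form G X \<phi> u v =
    (\<Sum>x\<in>X. \<Sum>y\<in>X. coord u (orb x y) * coord v (orb y x)) / real (order G)"
proof -
  have "pair_form G X \<phi> u v = (\<Sum>p\<in>X \<times> X. coord u (orbit G (act2 X \<phi>) p) *
      coord v (orbit_star (orbit G (act2 X \<phi>) p))) / real (order G)"
    unfolding pair_form_orbits orbits2_def
    by (rule pairs.sum_orbits_weighted) (use finite_group finite_set in auto)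
  also have "\<dots> = (\<Sum>(x, y)\<in>X \<times> X. coord u (orb x y) * coord v (orb y x)) / real (order G)"
    by (intro arg_cong2[where f="(/)"] sum.cong) (auto simp: orbit_star_orb)
  finally show ?thesis
    by (simp add: sum.cartesian_product)
qed

text \<open>Pairing with the basis vector of \<open>b\<^sup>\<star>\<close> isolates the coefficient of \<open>b\<close>, up to the nonzero
  factor \<open>1 / |Aut b|\<close>. So the product of the orbit algebra is well determined by its pairings.\<close>

lemma pair_form_nondegenerate:
  assumes "p \<in> free_space \<B>" "q \<in> free_space \<B>"
    and eq: "\<And>w. w \<in> free_space \<B> \<Longrightarrow> pair_form G X \<phi> p w = pair_form G X \<phi> q w"
  shows "p = q"
proof (rule poly_mapping_eqI)
  fix b
  show "coord p b = coord q b"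
  proof (cases "b \<in> \<B>")
    case True
    have "orbit_star b = orbit_star b' \<longleftrightarrow> b' = b" for b' :: "('x \<times> 'x) set"
      by (metis orbit_star_star)
    then have delta: "coord (basis_vec (orbit_star b)) (orbit_star b') = (if b' = b then 1 else 0 :: real)"
      for b'
      by (simp add: lookup_single when_def)
    have *: "pair_form G X \<phi> r (basis_vec (orbit_star b)) =
        coord r b / real (aut_card G (act2 X \<phi>) b)" for r
      using True unfolding pair_form_orbits delta by (simp add: if_distrib if_distribR cong: if_cong)
    have "aut_card G (act2 X \<phi>) b \<noteq> 0"
      using pairs.card_orbit_mult_aut_card[of b] True order_pos[OF finite_group]
      by (metis mult_0_right less_irrefl orbits2_def)
    then show ?thesis
      using eq[of "basis_vec (orbit_star b)"] True by (simp add: *)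
  next
    case False
    then show ?thesis
      using assms by (simp add: free_space_iff)
  qed
qed

text \<open>The orbit of \<open>(x, y, z)\<close> contributes to the coefficient of exactly one triple of pair orbits,
  those of \<open>(x, y)\<close>, \<open>(y, z)\<close> and \<open>(z, x)\<close>. Summing over the triples of pair orbits first therefore leaves
  a weighted sum over orbits of triples, which is an average over \<open>X\<^sup>3\<close>.\<close>

lemma triple_form_average:
  "triple_form G X \<phi> u v w =
    (\<Sum>x\<in>X. \<Sum>y\<in>X. \<Sum>z\<in>X. coord u (orb x y) * coord v (orb y z) * coord w (orb z x))
      / real (order G)"
proof -
  define C where "C t b1 b2 b3 \<longleftrightarrow>
    (\<forall>(x1, x2, x3)\<in>t. (x1, x2) \<in> b1 \<and> (x2, x3) \<in> b2 \<and> (x3, x1) \<in> b3)"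
    for t :: "('x \<times> 'x \<times> 'x) set" and b1 b2 b3
  \<comment> \<open>Written as a function of the orbit alone, so that no representative has to be chosen.\<close>
  define F where "F t = (\<Sum>b1\<in>\<B>. \<Sum>b2\<in>\<B>. \<Sum>b3\<in>\<B>.
    if C t b1 b2 b3 then coord u b1 * coord v b2 * coord w b3 else 0)" for t
  have fin: "finite (orbits3 G X \<phi>)"
    using triples.finite_orbits finite_set by (simp add: orbits3_def)
  have C: "C (orbit G (act3 X \<phi>) (x, y, z)) b1 b2 b3 \<longleftrightarrow>
      b1 = orb x y \<and> b2 = orb y z \<and> b3 = orb z x"
    if "x \<in> X" "y \<in> X" "z \<in> X" "b1 \<in> \<B>" "b2 \<in> \<B>" "b3 \<in> \<B>" for x y z b1 b2 b3
  proof
    assume "C (orbit G (act3 X \<phi>) (x, y, z)) b1 b2 b3"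
    moreover have "(x, y, z) \<in> orbit G (act3 X \<phi>) (x, y, z)"
      using triples.orbit_refl that by simp
    ultimately show "b1 = orb x y \<and> b2 = orb y z \<and> b3 = orb z x"
      using that by (auto simp: C_def mem_orb_iff)
  next
    assume "b1 = orb x y \<and> b2 = orb y z \<and> b3 = orb z x"
    then show "C (orbit G (act3 X \<phi>) (x, y, z)) b1 b2 b3"
      using that by (auto simp: C_def orbit3_eq orb_eq)
  qed
  have F: "F (orbit G (act3 X \<phi>) (x, y, z)) =
      coord u (orb x y) * coord v (orb y z) * coord w (orb z x)"
    if "x \<in> X" "y \<in> X" "z \<in> X" for x y z
  proof -
    have "F (orbit G (act3 X \<phi>) (x, y, z)) = (\<Sum>b1\<in>\<B>. \<Sum>b2\<in>\<B>. \<Sum>b3\<in>\<B>.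
        if b1 = orb x y then if b2 = orb y z then if b3 = orb z x
        then coord u b1 * coord v b2 * coord w b3 else 0 else 0 else 0)"
      unfolding F_def by (intro sum.cong refl) (simp add: C that)
    also have "\<dots> = coord u (orb x y) * coord v (orb y z) * coord w (orb z x)"
    proof -
      have "(\<Sum>b3\<in>\<B>. if b1 = orb x y then if b2 = orb y z then if b3 = orb z x
          then coord u b1 * coord v b2 * coord w b3 else 0 else 0 else 0) =
          (if b1 = orb x y then if b2 = orb y z
            then coord u b1 * coord v b2 * coord w (orb z x) else 0 else 0)" for b1 b2
        using that by simp
      moreover have "(\<Sum>b2\<in>\<B>. if b1 = orb x y then if b2 = orb y z
            then coord u b1 * coord v b2 * coord w (orb z x) else 0 else 0) =
          (if b1 = orb x y then coord u b1 * coord v (orb y z) * coord w (orb z x) else 0)" for b1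
        using that by simp
      ultimately show ?thesis
        using that by simp
    qed
    finally show ?thesis .
  qed
  have "coord u b1 * coord v b2 * coord w b3 * triple_coeff G X \<phi> b1 b2 b3 =
      (\<Sum>t\<in>orbits3 G X \<phi>. (if C t b1 b2 b3 then coord u b1 * coord v b2 * coord w b3 else 0)
        / real (aut_card G (act3 X \<phi>) t))" for b1 b2 b3
  proof -
    have "triple_coeff G X \<phi> b1 b2 b3 =
        (\<Sum>t\<in>orbits3 G X \<phi>. if C t b1 b2 b3 then 1 / real (aut_card G (act3 X \<phi>) t) else 0)"
      unfolding triple_coeff_def C_def by (rule sum.inter_filter[OF fin])
    then show ?thesis
      by (simp only: sum_distrib_left) (intro sum.cong refl, simp)
  qed
  then have "triple_form G X \<phi> u v w = (\<Sum>b1\<in>\<B>. \<Sum>b2\<in>\<B>. \<Sum>b3\<in>\<B>. \<Sum>t\<in>orbits3 G X \<phi>.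
      (if C t b1 b2 b3 then coord u b1 * coord v b2 * coord w b3 else 0)
        / real (aut_card G (act3 X \<phi>) t))"
    by (simp add: triple_form_def)
  also have "\<dots> = (\<Sum>b1\<in>\<B>. \<Sum>b2\<in>\<B>. \<Sum>t\<in>orbits3 G X \<phi>. \<Sum>b3\<in>\<B>.
      (if C t b1 b2 b3 then coord u b1 * coord v b2 * coord w b3 else 0)
        / real (aut_card G (act3 X \<phi>) t))"
    by (intro sum.cong refl) (rule sum.swap)
  also have "\<dots> = (\<Sum>b1\<in>\<B>. \<Sum>t\<in>orbits3 G X \<phi>. \<Sum>b2\<in>\<B>. \<Sum>b3\<in>\<B>.
      (if C t b1 b2 b3 then coord u b1 * coord v b2 * coord w b3 else 0)
        / real (aut_card G (act3 X \<phi>) t))"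
    by (intro sum.cong refl) (rule sum.swap)
  also have "\<dots> = (\<Sum>t\<in>orbits3 G X \<phi>. \<Sum>b1\<in>\<B>. \<Sum>b2\<in>\<B>. \<Sum>b3\<in>\<B>.
      (if C t b1 b2 b3 then coord u b1 * coord v b2 * coord w b3 else 0)
        / real (aut_card G (act3 X \<phi>) t))"
    by (rule sum.swap)
  also have "\<dots> = (\<Sum>t\<in>orbits3 G X \<phi>. F t / real (aut_card G (act3 X \<phi>) t))"
    by (simp only: F_def sum_divide_distrib)
  also have "\<dots> = (\<Sum>p\<in>X \<times> X \<times> X. F (orbit G (act3 X \<phi>) p)) / real (order G)"
    unfolding orbits3_def
    by (rule triples.sum_orbits_weighted) (use finite_group finite_set in auto)
  also have "(\<Sum>p\<in>X \<times> X \<times> X. F (orbit G (act3 X \<phi>) p)) = (\<Sum>(x, y, z)\<in>X \<times> X \<times> X.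
      coord u (orb x y) * coord v (orb y z) * coord w (orb z x))"
    by (rule sum.cong) (auto simp: F)
  finally show ?thesis
    by (simp add: sum.cartesian_product)
qed

section \<open>The orbit algebra as the algebra of invariant matrices\<close>

lemma free_space_orbits_eqI:
  assumes "u \<in> free_space \<B>" "v \<in> free_space \<B>"
    and "\<And>x y. x \<in> X \<Longrightarrow> y \<in> X \<Longrightarrow> coord u (orb x y) = coord v (orb x y)"
  shows "u = v"
proof (rule poly_mapping_eqI)
  fix b
  show "coord u b = coord v b"
    using assms by (cases "b \<in> \<B>") (auto simp: free_space_iff elim: orbits2_cases)
qed

definition invariant :: "('x \<Rightarrow> 'x \<Rightarrow> real) \<Rightarrow> bool" where
  "invariant M \<longleftrightarrow> (\<forall>g\<in>carrier G. \<forall>x\<in>X. \<forall>y\<in>X. M (\<phi> g x) (\<phi> g y) = M x y)"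

text \<open>The orbit space element with matrix \<open>M\<close>. Each coefficient is read off at a chosen point of the
  orbit, so it is meaningful only when \<open>M\<close> is invariant.\<close>

definition orbit_vec :: "('x \<Rightarrow> 'x \<Rightarrow> real) \<Rightarrow> (('x \<times> 'x) set \<Rightarrow>\<^sub>0 real)" where
  "orbit_vec M = (\<Sum>b\<in>\<B>. case_prod M (SOME p. p \<in> b) *\<^sub>R basis_vec b)"

lemma orbit_vec_in [simp]: "orbit_vec M \<in> free_space \<B>"
  by (simp add: orbit_vec_def free_space_sum)

lemma coord_orbit_vec:
  assumes M: "invariant M" and xy: "x \<in> X" "y \<in> X"
  shows "coord (orbit_vec M) (orb x y) = M x y"
proof -
  have "(SOME p. p \<in> orb x y) \<in> orb x y"
    using pairs.some_mem_orbit pairs.orbit_in_orbits xy by simp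
  then obtain g where "g \<in> carrier G" "(SOME p. p \<in> orb x y) = (\<phi> g x, \<phi> g y)"
    using xy by (auto simp: orb_eq)
  then show ?thesis
    using M xy by (simp add: orbit_vec_def coord_basis_sum invariant_def)
qed

lemma sum_act:
  assumes "g \<in> carrier G"
  shows "(\<Sum>x\<in>X. F (\<phi> g x)) = (\<Sum>x\<in>X. F x)"
  using assms by (intro sum.reindex_bij_betw) (simp add: bij_betw_def inj_prop surj_prop)

text \<open>The orbit product is the matrix product: the pairing of a matrix product with \<open>w\<close> expands
  to the cyclic sum that computes the triple form, and nondegeneracy gives uniqueness.\<close>

lemma orbit_mult_eqI:
  assumes p: "p \<in> free_space \<B>"
    and coord: "\<And>x z. x \<in> X \<Longrightarrow> z \<in> X \<Longrightarrow>
      coord p (orb x z) = (\<Sum>y\<in>X. coord u (orb x y) * coord v (orb y z))"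
  shows "orbit_mult G X \<phi> u v = p"
proof -
  have *: "pair_form G X \<phi> p w = triple_form G X \<phi> u v w" for w
  proof -
    have "(\<Sum>x\<in>X. \<Sum>z\<in>X. coord p (orb x z) * coord w (orb z x)) =
        (\<Sum>x\<in>X. \<Sum>z\<in>X. \<Sum>y\<in>X. coord u (orb x y) * coord v (orb y z) * coord w (orb z x))"
      by (simp add: coord sum_distrib_right)
    also have "\<dots> =
        (\<Sum>x\<in>X. \<Sum>y\<in>X. \<Sum>z\<in>X. coord u (orb x y) * coord v (orb y z) * coord w (orb z x))"
      by (rule sum.cong[OF refl]) (rule sum.swap)
    finally show ?thesis
      by (simp add: pair_form_average triple_form_average)
  qed
  show ?thesis
    unfolding orbit_mult_def
  proof (rule the_equality)
    fix q
    assume "q \<in> free_space \<B> \<and> (\<forall>w\<in>free_space \<B>. pair_form G X \<phi> q w = triple_form G X \<phi> u v w)"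
    then show "q = p"
      using p by (intro pair_form_nondegenerate) (auto simp: *)
  qed (use p * in auto)
qed

lemma orbit_unit_in: "orbit_unit G X \<phi> \<in> free_space \<B>"
  by (auto simp: orbit_unit_def intro!: free_space_sum)

lemma coord_orbit_unit:
  assumes "x \<in> X" "y \<in> X"
  shows "coord (orbit_unit G X \<phi>) (orb x y) = (if x = y then 1 else 0)"
proof -
  have "orb x y \<subseteq> {(x, x) | x. x \<in> X} \<longleftrightarrow> x = y"
    using assms pairs.orbit_refl[of "(x, y)"] by (auto simp: orb_eq)
  then show ?thesis
    using assms by (simp add: orbit_unit_def lookup_sum lookup_single when_def)
qed

lemma orbit_functional_eq:
  "orbit_functional G X \<phi> u = (\<Sum>x\<in>X. coord u (orb x x)) / real (order G)"
  using finite_set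
  by (simp add: orbit_functional_def pair_form_average coord_orbit_unit if_distrib cong: if_cong)

lemma orbit_alg_star_in: "orbit_alg_star G X \<phi> u \<in> free_space \<B>"
  by (auto simp: orbit_alg_star_def intro!: free_space_sum)

lemma coord_orbit_alg_star:
  assumes "x \<in> X" "y \<in> X"
  shows "coord (orbit_alg_star G X \<phi> u) (orb x y) = coord u (orb y x)"
proof -
  have "orbit_star b = orb x y \<longleftrightarrow> b = orb y x" for b
    using assms orbit_star_orb orbit_star_star by metis
  then show ?thesis
    using assms by (simp add: orbit_alg_star_def lookup_sum lookup_single when_def if_distrib cong: if_cong)
qed

section \<open>Equivariant endomorphisms are the invariant matrices\<close>

lemma coord_perm_rep:
  assumes g: "g \<in> carrier G" and x: "x \<in> X"
  shows "coord (perm_rep X \<phi> g v) (\<phi> g x) = coord v x"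
proof -
  have "\<phi> g y = \<phi> g x \<longleftrightarrow> y = x" if "y \<in> X" for y
    using inj_prop[OF g] x that by (auto dest: inj_onD)
  then have "coord (perm_rep X \<phi> g v) (\<phi> g x) = (\<Sum>y\<in>X. if y = x then coord v y else 0)"
    unfolding perm_rep_def lookup_sum
    by (intro sum.cong refl) (simp add: lookup_single when_def)
  then show ?thesis
    using x finite_set by simp
qed

lemma perm_rep_in: "g \<in> carrier G \<Longrightarrow> perm_rep X \<phi> g v \<in> free_space X"
  by (auto simp: perm_rep_def intro!: free_space_sum)

text \<open>It is enough to compare coordinates at translated points because \<open>g\<close> permutes \<open>X\<close>; these
  are the points at which \<open>coord_perm_rep\<close> evaluates the representation without an inverse.\<close>

lemma free_space_eqI_act:
  assumes g: "g \<in> carrier G" and "v \<in> free_space X" "w \<in> free_space X"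
    and eq: "\<And>x. x \<in> X \<Longrightarrow> coord v (\<phi> g x) = coord w (\<phi> g x)"
  shows "v = w"
proof (rule poly_mapping_eqI)
  fix i
  show "coord v i = coord w i"
  proof (cases "i \<in> X")
    case True
    then show ?thesis using surj_prop[OF g] eq by (metis imageE)
  qed (use assms in \<open>simp add: free_space_iff\<close>)
qed

text \<open>One direction evaluates the commutation with \<open>g\<close> on basis vectors. The other expands
  \<open>f (g v)\<close> by the matrix of \<open>f\<close> and substitutes \<open>g y\<close> for the summation variable.\<close>

lemma End_carrier_iff:
  "f \<in> carrier (End_alg G X \<phi>) \<longleftrightarrow> f \<in> lin_endos X \<and> invariant (mat_entry f)"
proof (intro iffI conjI)
  assume f: "f \<in> carrier (End_alg G X \<phi>)"
  then show "f \<in> lin_endos X"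
    by (simp add: End_alg_def)
  show "invariant (mat_entry f)"
    unfolding invariant_def
  proof (intro ballI)
    fix g x y assume g: "g \<in> carrier G" and xy: "x \<in> X" "y \<in> X"
    have "perm_rep X \<phi> g (basis_vec y) = basis_vec (\<phi> g y)"
      unfolding perm_rep_def using xy finite_set
      by (simp add: lookup_single when_def if_distrib if_distribR cong: if_cong)
    then have "f (basis_vec (\<phi> g y)) = perm_rep X \<phi> g (f (basis_vec y))"
      using f g xy by (auto simp: End_alg_def dest!: bspec[of _ _ g] bspec[of _ _ "basis_vec y"])
    then show "mat_entry f (\<phi> g x) (\<phi> g y) = mat_entry f x y"
      using coord_perm_rep g xy by (simp add: mat_entry_def)
  qed
next
  assume "f \<in> lin_endos X \<and> invariant (mat_entry f)"
  then have f: "f \<in> lin_endos X" and inv: "invariant (mat_entry f)"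
    by auto
  have "f (perm_rep X \<phi> g v) = perm_rep X \<phi> g (f v)"
    if g: "g \<in> carrier G" and v: "v \<in> free_space X" for g v
  proof (rule free_space_eqI_act[OF g])
    fix x assume x: "x \<in> X"
    have "coord (f (perm_rep X \<phi> g v)) (\<phi> g x) =
        (\<Sum>y\<in>X. mat_entry f (\<phi> g x) y * coord (perm_rep X \<phi> g v) y)"
      by (rule coord_lin_endo[OF f finite_set perm_rep_in[OF g]])
    also have "\<dots> = (\<Sum>y\<in>X. mat_entry f (\<phi> g x) (\<phi> g y) * coord (perm_rep X \<phi> g v) (\<phi> g y))"
      by (rule sum_act[OF g, symmetric])
    also have "\<dots> = (\<Sum>y\<in>X. mat_entry f x y * coord v y)"
      using inv g x by (intro sum.cong) (auto simp: invariant_def coord_perm_rep)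
    also have "\<dots> = coord (f v) x"
      by (rule coord_lin_endo[OF f finite_set v, symmetric])
    finally show "coord (f (perm_rep X \<phi> g v)) (\<phi> g x) = coord (perm_rep X \<phi> g (f v)) (\<phi> g x)"
      using g x by (simp add: coord_perm_rep)
  qed (use lin_endosD(1)[OF f] perm_rep_in g in auto)
  then show "f \<in> carrier (End_alg G X \<phi>)"
    using f by (simp add: End_alg_def)
qed

lemma mat_endo_in_End:
  assumes "invariant M"
  shows "mat_endo X M \<in> carrier (End_alg G X \<phi>)"
  using assms finite_set
  by (auto simp: End_carrier_iff mat_endo_lin_endos invariant_def mat_entry_mat_endo)

lemma mat_entry_End_ops:
  assumes "y \<in> X"
  shows "mat_entry (f \<oplus>\<^bsub>End_alg G X \<phi>\<^esub> f') x y = mat_entry f x y + mat_entry f' x y"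
    and "mat_entry (c \<odot>\<^bsub>End_alg G X \<phi>\<^esub> f) x y = c * mat_entry f x y"
    and "mat_entry \<one>\<^bsub>End_alg G X \<phi>\<^esub> x y = (if x = y then 1 else 0)"
  using assms by (auto simp: End_alg_def mat_entry_def lookup_add lookup_single when_def)

definition End_to_orbit :: "(('x \<Rightarrow>\<^sub>0 real) \<Rightarrow> ('x \<Rightarrow>\<^sub>0 real)) \<Rightarrow> (('x \<times> 'x) set \<Rightarrow>\<^sub>0 real)" where
  "End_to_orbit f = orbit_vec (mat_entry f)"

text \<open>The entries are compared only on \<open>X \<times> X\<close>: a basis vector outside \<open>X\<close> does not lie in the
  space, and the entries of endomorphisms there carry no information.\<close>

lemma coord_End_to_orbit:
  assumes "\<And>x y. x \<in> X \<Longrightarrow> y \<in> X \<Longrightarrow> mat_entry f x y = M x y" "invariant M" "x \<in> X" "y \<in> X"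
  shows "coord (End_to_orbit f) (orb x y) = M x y"
proof -
  have "invariant (mat_entry f)"
    using assms(1,2) by (simp add: invariant_def)
  then show ?thesis
    using assms by (simp add: End_to_orbit_def coord_orbit_vec)
qed

lemma coord_End_to_orbit_carrier:
  assumes "f \<in> carrier (End_alg G X \<phi>)" "x \<in> X" "y \<in> X"
  shows "coord (End_to_orbit f) (orb x y) = mat_entry f x y"
  using assms by (simp add: End_carrier_iff End_to_orbit_def coord_orbit_vec)

text \<open>Invariance of \<open>f\<close> comes for free: its matrix agrees with that of \<open>u\<close>, which is constant on
  orbits by construction. Sums, multiples, the unit and the adjoint are handled this way.\<close>

lemma End_to_orbit_eqI:
  assumes "u \<in> free_space \<B>"
    and eq: "\<And>x y. x \<in> X \<Longrightarrow> y \<in> X \<Longrightarrow> mat_entry f x y = coord u (orb x y)"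
  shows "End_to_orbit f = u"
proof (rule free_space_orbits_eqI)
  fix x y assume "x \<in> X" "y \<in> X"
  then show "coord (End_to_orbit f) (orb x y) = coord u (orb x y)"
    using eq by (intro coord_End_to_orbit) (auto simp: invariant_def orb_act)
qed (use assms in \<open>simp_all add: End_to_orbit_def\<close>)

lemma End_to_orbit_bij:
  "bij_betw End_to_orbit (carrier (End_alg G X \<phi>)) (free_space \<B>)"
  unfolding bij_betw_def
proof
  show "inj_on End_to_orbit (carrier (End_alg G X \<phi>))"
  proof (rule inj_onI)
    fix f f' assume ff': "f \<in> carrier (End_alg G X \<phi>)" "f' \<in> carrier (End_alg G X \<phi>)"
      and "End_to_orbit f = End_to_orbit f'"
    then have "mat_entry f x y = mat_entry f' x y" if "x \<in> X" "y \<in> X" for x y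
      using that coord_End_to_orbit_carrier by metis
    then show "f = f'"
      using ff' finite_set by (intro lin_endo_eqI) (auto simp: End_carrier_iff)
  qed
  have "u \<in> End_to_orbit ` carrier (End_alg G X \<phi>)" if "u \<in> free_space \<B>" for u
  proof
    let ?f = "mat_endo X (\<lambda>x y. coord u (orb x y))"
    show "u = End_to_orbit ?f"
      by (rule sym, rule End_to_orbit_eqI) (use that finite_set in \<open>auto simp: mat_entry_mat_endo\<close>)
    show "?f \<in> carrier (End_alg G X \<phi>)"
      by (rule mat_endo_in_End) (auto simp: invariant_def orb_act)
  qed
  then show "End_to_orbit ` carrier (End_alg G X \<phi>) = free_space \<B>"
    by (auto simp: End_to_orbit_def)
qed

lemma End_to_orbit_mult:
  assumes f: "f \<in> carrier (End_alg G X \<phi>)" and f': "f' \<in> carrier (End_alg G X \<phi>)"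
  shows "End_to_orbit (f \<otimes>\<^bsub>End_alg G X \<phi>\<^esub> f') = orbit_mult G X \<phi> (End_to_orbit f) (End_to_orbit f')"
proof (rule sym, rule orbit_mult_eqI)
  define M where "M x z = (\<Sum>y\<in>X. mat_entry f x y * mat_entry f' y z)" for x z
  have inv: "invariant M"
    unfolding invariant_def
  proof (intro ballI)
    fix g x z assume g: "g \<in> carrier G" and xz: "x \<in> X" "z \<in> X"
    have "M (\<phi> g x) (\<phi> g z) =
        (\<Sum>y\<in>X. mat_entry f (\<phi> g x) (\<phi> g y) * mat_entry f' (\<phi> g y) (\<phi> g z))"
      unfolding M_def by (rule sum_act[OF g, symmetric])
    also have "\<dots> = M x z"
      unfolding M_def using f f' g xz
      by (intro sum.cong) (auto simp: End_carrier_iff invariant_def)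
    finally show "M (\<phi> g x) (\<phi> g z) = M x z" .
  qed
  fix x z assume "x \<in> X" "z \<in> X"
  then have "coord (End_to_orbit (f \<otimes>\<^bsub>End_alg G X \<phi>\<^esub> f')) (orb x z) = M x z"
    using f f' finite_set
    by (intro coord_End_to_orbit inv)
      (auto simp: M_def End_carrier_iff mat_entry_compose End_alg_def)
  then show "coord (End_to_orbit (f \<otimes>\<^bsub>End_alg G X \<phi>\<^esub> f')) (orb x z) =
      (\<Sum>y\<in>X. coord (End_to_orbit f) (orb x y) * coord (End_to_orbit f') (orb y z))"
    using f f' \<open>x \<in> X\<close> \<open>z \<in> X\<close> by (simp add: M_def coord_End_to_orbit_carrier)
qed (simp add: End_to_orbit_def)

lemma End_to_orbit_iso: "End_to_orbit \<in> real_alg_iso (End_alg G X \<phi>) (orbit_alg G X \<phi>)"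
proof -
  have in_free: "End_to_orbit f \<in> free_space \<B>" for f
    by (simp add: End_to_orbit_def)
  have "End_to_orbit (f \<oplus>\<^bsub>End_alg G X \<phi>\<^esub> f') = End_to_orbit f + End_to_orbit f'"
    if "f \<in> carrier (End_alg G X \<phi>)" "f' \<in> carrier (End_alg G X \<phi>)" for f f'
    using that in_free
    by (intro End_to_orbit_eqI) (auto simp: mat_entry_End_ops lookup_add coord_End_to_orbit_carrier)
  moreover have "End_to_orbit (c \<odot>\<^bsub>End_alg G X \<phi>\<^esub> f) = c *\<^sub>R End_to_orbit f"
    if "f \<in> carrier (End_alg G X \<phi>)" for c f
    using that in_free
    by (intro End_to_orbit_eqI) (auto simp: mat_entry_End_ops coord_End_to_orbit_carrier)
  moreover have "End_to_orbit \<one>\<^bsub>End_alg G X \<phi>\<^esub> = orbit_unit G X \<phi>"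
    by (intro End_to_orbit_eqI) (auto simp: mat_entry_End_ops coord_orbit_unit orbit_unit_in)
  ultimately show ?thesis
    using End_to_orbit_bij End_to_orbit_mult in_free
    by (auto simp: real_alg_iso_def ring_iso_def ring_hom_def orbit_alg_def)
qed

lemma orbit_functional_End_to_orbit:
  assumes "f \<in> carrier (End_alg G X \<phi>)"
  shows "orbit_functional G X \<phi> (End_to_orbit f) = End_functional G X f"
  using coord_End_to_orbit_carrier[OF assms]
  by (simp add: orbit_functional_eq End_functional_def endo_trace_def mat_entry_def)

lemma End_to_orbit_adjoint:
  assumes f: "f \<in> carrier (End_alg G X \<phi>)"
  shows "End_to_orbit (endo_adjoint X f) = orbit_alg_star G X \<phi> (End_to_orbit f)"
proof (rule End_to_orbit_eqI[OF orbit_alg_star_in])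
  have lin: "f \<in> lin_endos X"
    using f by (simp add: End_carrier_iff)
  fix x y assume "x \<in> X" "y \<in> X"
  then show "mat_entry (endo_adjoint X f) x y =
      coord (orbit_alg_star G X \<phi> (End_to_orbit f)) (orb x y)"
    using finite_set
    by (simp add: endo_adjoint_eq_transpose[OF lin finite_set] mat_entry_mat_endo
        coord_orbit_alg_star coord_End_to_orbit_carrier[OF f])
qed

end

section \<open>The isomorphism\<close>

theorem theorem8:
  fixes G :: "('g, 'm) monoid_scheme" and X :: "'x set" and \<phi> :: "'g \<Rightarrow> 'x \<Rightarrow> 'x"
  assumes "group_action G X \<phi>" and "finite (carrier G)" and "finite X"
  shows "\<exists>h \<in> real_alg_iso (End_alg G X \<phi>) (orbit_alg G X \<phi>).
    (\<forall>f\<in>carrier (End_alg G X \<phi>). orbit_functional G X \<phi> (h f) = End_functional G X f) \<and>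
    (\<forall>f\<in>carrier (End_alg G X \<phi>). h (endo_adjoint X f) = orbit_alg_star G X \<phi> (h f))"
proof -
  interpret finite_action G X \<phi>
    using assms by (intro finite_action.intro finite_action_axioms.intro)
  show ?thesis
    using End_to_orbit_iso orbit_functional_End_to_orbit End_to_orbit_adjoint by blast
qed

end
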